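(* Let $\mathcal{H}$ be a complex Hilbert space and $A\in\mathcal{B}(\mathcal{H})$ a positive operator. Let $U\in\mathcal{B}_A(\mathcal{H})$ be an $A$-unitary operator and $T\in\mathcal{B}_{A^{1/2}}(\mathcal{H})$. Then, for each choice of sign $\pm$, $$r_A(TU\pm UT)\leq\|T\|_A+\|T^2\|_A^{1/2}.$$
   Context: $\mathcal{B}(\mathcal{H})$ is the algebra of bounded linear operators on the complex Hilbert space $(\mathcal{H},\langle\cdot\mid\cdot\rangle)$. For positive $A$, put $\langle x\mid y\rangle_A=\langle Ax\mid y\rangle$ and $\|x\|_A=\langle x\mid x\rangle_A^{1/2}=\|A^{1/2}x\|$. $\mathcal{B}_{A^{1/2}}(\mathcal{H})$ is the set of $T\in\mathcal{B}(\mathcal{H})$ for which there is $\lambda>0$ with $\|Tx\|_A\le\lambda\|x\|_A$ for all $x\in\mathcal{H}$ ($A$-bounded operators). For such $T$, $\|T\|_A=\sup\{\|Tx\|_A: x\in\mathcal{H},\ \|x\|_A=1\}$ (a supremum over the empty set, occurring only if $A=0$, is $0$), and the $A$-spectral radius is $r_A(T)=\inf_{n\ge1}\|T^n\|_A^{1/n}=\lim_{n\to\infty}\|T^n\|_A^{1/n}$. $\mathcal{B}_A(\mathcal{H})$ is the set of $T\in\mathcal{B}(\mathcal{H})$ for which $AX=T^*A$ has a solution $X\in\mathcal{B}(\mathcal{H})$ (equivalently $\mathcal{R}(T^*A)\subseteq\mathcal{R}(A)$); one has $\mathcal{B}_A(\mathcal{H})\subseteq\mathcal{B}_{A^{1/2}}(\mathcal{H})$.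 For $T\in\mathcal{B}_A(\mathcal{H})$, $T^{\sharp_A}$ denotes the unique solution $X\in\mathcal{B}(\mathcal{H})$ of $AX=T^*A$ with $\mathcal{R}(X)\subseteq\overline{\mathcal{R}(A)}$; it again lies in $\mathcal{B}_A(\mathcal{H})$. $P_A$ is the orthogonal projection onto $\overline{\mathcal{R}(A)}$. An operator $U\in\mathcal{B}_A(\mathcal{H})$ is $A$-unitary if $U^{\sharp_A}U=(U^{\sharp_A})^{\sharp_A}U^{\sharp_A}=P_A$. *)

theory Defs
  imports "HOL-Analysis.Analysis"
begin

text \<open>
  Complex Hilbert spaces. The inner product is linear in the first and conjugate-linear in
  the second argument. The real vector space structure, norm and topology provided by
  \<^class>\<open>real_normed_vector\<close> are tied to the complex structure by
  \<open>scaleR_scaleC\<close> and \<open>norm_eq_sqrt_cinner\<close>. The zero space is not excluded.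
\<close>

class complex_inner = real_normed_vector +
  fixes scaleC :: "complex \<Rightarrow> 'a \<Rightarrow> 'a"  (infixr "*\<^sub>C" 75)
    and cinner :: "'a \<Rightarrow> 'a \<Rightarrow> complex"
  assumes scaleC_add_right: "a *\<^sub>C (x + y) = a *\<^sub>C x + a *\<^sub>C y"
    and scaleC_add_left: "(a + b) *\<^sub>C x = a *\<^sub>C x + b *\<^sub>C x"
    and scaleC_scaleC: "a *\<^sub>C (b *\<^sub>C x) = (a * b) *\<^sub>C x"
    and scaleC_one: "1 *\<^sub>C x = x"
    and scaleR_scaleC: "r *\<^sub>R x = complex_of_real r *\<^sub>C x"
    and cinner_add_left: "cinner (x + y) z = cinner x z + cinner y z"
    and cinner_scaleC_left: "cinner (a *\<^sub>C x) y = a * cinner x y"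
    and cinner_commute: "cinner y x = cnj (cinner x y)"
    and cinner_pos: "x \<noteq> 0 \<Longrightarrow> 0 < Re (cinner x x)"
    and norm_eq_sqrt_cinner: "norm x = sqrt (Re (cinner x x))"

class complex_hilbert_space = complex_inner + complete_space

instantiation complex :: complex_hilbert_space
begin

definition scaleC_complex :: "complex \<Rightarrow> complex \<Rightarrow> complex"
  where "scaleC_complex a x = a * x"

definition cinner_complex :: "complex \<Rightarrow> complex \<Rightarrow> complex"
  where "cinner_complex x y = x * cnj y"

instance
proof
  fix x :: complex
  show "0 < Re (cinner x x)" if "x \<noteq> 0"
    using that by (simp add: cinner_complex_def complex_mult_cnj complex_neq_0)
  show "norm x = sqrt (Re (cinner x x))"
    by (simp add: cinner_complex_def cmod_def power2_eq_square)
qed (auto simp: scaleC_complex_def cinner_complex_def algebra_simps scaleR_conv_of_real)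

end

text \<open>Operators are functions on the space; \<open>bounded_clinear\<close> singles out the algebra of
  bounded complex-linear operators. Products are compositions, so the \<open>n\<close>-th power is \<open>T ^^ n\<close>.\<close>

definition bounded_clinear :: "('a::complex_inner \<Rightarrow> 'a) \<Rightarrow> bool"
  where "bounded_clinear T \<longleftrightarrow> bounded_linear T \<and> (\<forall>c x. T (c *\<^sub>C x) = c *\<^sub>C T x)"

definition positive_op :: "('a::complex_inner \<Rightarrow> 'a) \<Rightarrow> bool"
  where "positive_op A \<longleftrightarrow>
    bounded_clinear A \<and> (\<forall>x. cinner (A x) x \<in> \<real> \<and> 0 \<le> Re (cinner (A x) x))"

definition cadjoint :: "('a::complex_inner \<Rightarrow> 'a) \<Rightarrow> 'a \<Rightarrow> 'a"
  where "cadjoint T =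
    (THE S. bounded_clinear S \<and> (\<forall>x y. cinner (T x) y = cinner x (S y)))"

definition orth_proj :: "'a::complex_inner set \<Rightarrow> 'a \<Rightarrow> 'a"
  where "orth_proj M x = (THE y. y \<in> M \<and> (\<forall>z\<in>M. cinner (x - y) z = 0))"

definition A_inner :: "('a::complex_inner \<Rightarrow> 'a) \<Rightarrow> 'a \<Rightarrow> 'a \<Rightarrow> complex"
  where "A_inner A x y = cinner (A x) y"

definition A_norm :: "('a::complex_inner \<Rightarrow> 'a) \<Rightarrow> 'a \<Rightarrow> real"
  where "A_norm A x = sqrt (Re (A_inner A x x))"

definition A_bounded_ops :: "('a::complex_inner \<Rightarrow> 'a) \<Rightarrow> ('a \<Rightarrow> 'a) set"
  where "A_bounded_ops A =
    {T. bounded_clinear T \<and> (\<exists>c>0. \<forall>x. A_norm A (T x) \<le> c * A_norm A x)}"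

text \<open>The index set below is empty only if \<open>A = 0\<close>; as \<open>Sup {}\<close> is unspecified
  on the reals, the value \<open>0\<close> is prescribed in that case.\<close>

definition A_opnorm :: "('a::complex_inner \<Rightarrow> 'a) \<Rightarrow> ('a \<Rightarrow> 'a) \<Rightarrow> real"
  where "A_opnorm A T =
    (if {x. A_norm A x = 1} = {} then 0 else SUP x\<in>{x. A_norm A x = 1}. A_norm A (T x))"

definition A_spectral_radius :: "('a::complex_inner \<Rightarrow> 'a) \<Rightarrow> ('a \<Rightarrow> 'a) \<Rightarrow> real"
  where "A_spectral_radius A T = (INF n\<in>{1..}. root n (A_opnorm A (T ^^ n)))"

definition A_adjointable_ops :: "('a::complex_inner \<Rightarrow> 'a) \<Rightarrow> ('a \<Rightarrow> 'a) set"
  where "A_adjointable_ops A =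
    {T. bounded_clinear T \<and> (\<exists>X. bounded_clinear X \<and> A \<circ> X = cadjoint T \<circ> A)}"

text \<open>The distinguished \<open>A\<close>-adjoint; meaningful for \<open>T \<in> A_adjointable_ops A\<close>.\<close>

definition A_adjoint :: "('a::complex_inner \<Rightarrow> 'a) \<Rightarrow> ('a \<Rightarrow> 'a) \<Rightarrow> 'a \<Rightarrow> 'a"
  where "A_adjoint A T =
    (THE X. bounded_clinear X \<and> A \<circ> X = cadjoint T \<circ> A \<and> range X \<subseteq> closure (range A))"

definition A_proj :: "('a::complex_inner \<Rightarrow> 'a) \<Rightarrow> 'a \<Rightarrow> 'a"
  where "A_proj A = orth_proj (closure (range A))"

definition A_unitary :: "('a::complex_inner \<Rightarrow> 'a) \<Rightarrow> ('a \<Rightarrow> 'a) \<Rightarrow> bool"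
  where "A_unitary A U \<longleftrightarrow>
    U \<in> A_adjointable_ops A \<and>
    A_adjoint A U \<circ> U = A_proj A \<and>
    A_adjoint A (A_adjoint A U) \<circ> A_adjoint A U = A_proj A"

end

theory Submission
  imports Defs
begin

text \<open>
  Write \<open>S = TU \<plusminus> UT\<close>. An \<open>A\<close>-unitary operator preserves the \<open>A\<close>-seminorm, so with
  \<open>t = \<parallel>T\<parallel>\<^sub>A\<close> and any \<open>s > 0\<close> such that \<open>\<parallel>T\<^sup>2\<parallel>\<^sub>A \<le> s\<^sup>2\<close>, the weighted functional
  \<open>\<phi> x = s \<parallel>U x\<parallel>\<^sub>A + \<parallel>T x\<parallel>\<^sub>A\<close> satisfies \<open>\<phi> (S x) \<le> (t + s) \<phi> x\<close>. Since \<open>\<parallel>S x\<parallel>\<^sub>A\<close> is dominated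
  by a multiple of \<open>\<phi> x\<close>, the powers of \<open>S\<close> grow at most like \<open>(t + s)\<^sup>n\<close>. That \<open>U\<close> preserves the
  seminorm is the identity \<open>U\<^sup>*AU = AU\<^sup>\<sharp>U = AP\<^sub>A = A\<close>.
\<close>

section \<open>Complex inner product spaces\<close>

lemma cinner_add_right: "cinner x (y + z) = cinner x y + cinner x (z::'a::complex_inner)"
  by (metis cinner_add_left cinner_commute complex_cnj_add)

lemma cinner_scaleC_right: "cinner x (a *\<^sub>C y) = cnj a * cinner x (y::'a::complex_inner)"
  by (metis cinner_commute cinner_scaleC_left complex_cnj_mult)

lemma scaleC_minus_one: "- x = (- 1) *\<^sub>C (x::'a::complex_inner)"
  using scaleR_scaleC[of "-1" x] by simp

lemma cinner_minus_left: "cinner (- x) y = - cinner x (y::'a::complex_inner)"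
  by (simp add: scaleC_minus_one[of x] cinner_scaleC_left)

lemma cinner_minus_right: "cinner x (- y) = - cinner x (y::'a::complex_inner)"
  by (simp add: scaleC_minus_one[of y] cinner_scaleC_right)

lemma cinner_diff_left: "cinner (x - y) z = cinner x z - cinner y (z::'a::complex_inner)"
  using cinner_add_left[of x "- y" z] by (simp add: cinner_minus_left)

lemma cinner_diff_right: "cinner x (y - z) = cinner x y - cinner x (z::'a::complex_inner)"
  using cinner_add_right[of x y "- z"] by (simp add: cinner_minus_right)

lemma cinner_zero_left [simp]: "cinner 0 (x::'a::complex_inner) = 0"
  using cinner_diff_left[of 0 0 x] by simp

lemma cinner_zero_right [simp]: "cinner (x::'a::complex_inner) 0 = 0"
  using cinner_diff_right[of x 0 0] by simp

lemma cinner_eq_zero_iff [simp]: "cinner x x = 0 \<longleftrightarrow> x = (0::'a::complex_inner)"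
  using cinner_pos[of x] by (cases "x = 0") auto

lemma cinner_scaleR_right: "cinner x (r *\<^sub>R y) = r * cinner x (y::'a::complex_inner)"
  by (simp add: scaleR_scaleC cinner_scaleC_right)

lemma cinner_self: "cinner x x = complex_of_real ((norm (x::'a::complex_inner))\<^sup>2)"
proof -
  have "Im (cinner x x) = 0"
    using cinner_commute[of x x] by (metis Reals_cnj_iff complex_is_Real_iff)
  moreover have "0 \<le> Re (cinner x x)"
    using cinner_pos[of x] by (cases "x = 0") auto
  ultimately show ?thesis
    by (simp add: norm_eq_sqrt_cinner complex_eq_iff)
qed

text \<open>The class links the norm to complex scalars only through the inner product, so
  homogeneity is read off the squared norm.\<close>

lemma norm_scaleC: "norm (a *\<^sub>C x) = cmod a * norm (x::'a::complex_inner)"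
proof -
  have "cinner (a *\<^sub>C x) (a *\<^sub>C x) = complex_of_real ((cmod a * norm x)\<^sup>2)"
    unfolding cinner_scaleC_left cinner_scaleC_right cinner_self[of x]
    using complex_norm_square[of a] by (simp add: power_mult_distrib)
  then have "(norm (a *\<^sub>C x))\<^sup>2 = (cmod a * norm x)\<^sup>2"
    by (simp only: cinner_self of_real_eq_iff)
  then show ?thesis
    by simp
qed

lemma scaleC_diff_right: "a *\<^sub>C (x - y) = a *\<^sub>C x - a *\<^sub>C (y::'a::complex_inner)"
  using scaleC_add_right[of a "x - y" y] by simp

lemma bounded_linear_scaleC: "bounded_linear (\<lambda>x::'a::complex_inner. a *\<^sub>C x)"
proof (rule bounded_linear_intro)
  show "a *\<^sub>C (r *\<^sub>R x) = r *\<^sub>R (a *\<^sub>C x)" for r and x :: 'a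
    by (simp add: scaleR_scaleC scaleC_scaleC mult.commute)
  show "norm (a *\<^sub>C x) \<le> norm x * cmod a" for x :: 'a
    by (simp add: norm_scaleC)
qed (simp add: scaleC_add_right)

section \<open>Bounded complex-linear operators\<close>

lemma bounded_clinearI:
  fixes T :: "'a::complex_inner \<Rightarrow> 'a"
  assumes "\<And>x y. T (x + y) = T x + T y" "\<And>c x. T (c *\<^sub>C x) = c *\<^sub>C T x"
    and "\<And>x. norm (T x) \<le> norm x * K"
  shows "bounded_clinear T"
  unfolding bounded_clinear_def using assms
  by (auto intro!: bounded_linear_intro[of T K] simp: scaleR_scaleC)

lemma bounded_clinear_compose:
  assumes "bounded_clinear S" "bounded_clinear T"
  shows "bounded_clinear (S \<circ> T)"
  using assms bounded_linear_compose[of S T] by (auto simp: bounded_clinear_def o_def)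

lemma bounded_clinear_add: "bounded_clinear T \<Longrightarrow> T (x + y) = T x + T y"
  by (simp add: bounded_clinear_def linear_simps(1))

lemma bounded_clinear_diff: "bounded_clinear T \<Longrightarrow> T (x - y) = T x - T y"
  by (simp add: bounded_clinear_def linear_simps(2))

lemma bounded_clinear_scaleC: "bounded_clinear T \<Longrightarrow> T (c *\<^sub>C x) = c *\<^sub>C T x"
  by (simp add: bounded_clinear_def)

lemma bounded_clinear_scaleR: "bounded_clinear T \<Longrightarrow> T (r *\<^sub>R x) = r *\<^sub>R T x"
  by (simp add: scaleR_scaleC bounded_clinear_scaleC)

text \<open>Serves Cauchy-Schwarz and, with \<open>q = 0\<close>, the orthogonality of nearest
  points.\<close>

lemma quadratic_nonneg_imp_discriminant:
  fixes p q b :: real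
  assumes nonneg: "\<And>r. 0 \<le> q + 2 * r * b + r\<^sup>2 * p" and "0 \<le> p"
  shows "b\<^sup>2 \<le> q * p"
proof (cases "p = 0")
  case True
  have "b = 0"
  proof (rule ccontr)
    assume "b \<noteq> 0"
    \<comment> \<open>At this \<open>r\<close> the polynomial, affine since \<open>p = 0\<close>,
      takes the value -1.\<close>
    then show False
      using nonneg[of "- (q + 1) / (2 * b)"] True by (simp add: field_simps)
  qed
  then show ?thesis
    using True by simp
next
  case False
  then have "p > 0"
    using assms by simp
  \<comment> \<open>The minimiser \<open>- b / p\<close> gives the sharpest inequality.\<close>
  then show ?thesis
    using nonneg[of "- b / p"] by (simp add: field_simps power2_eq_square)
qed

section \<open>The seminorm of a positive operator\<close>

text \<open>Polarisation: the form is real on the diagonal, and its values at \<open>x + y\<close>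
  and \<open>x + \<i> *\<^sub>C y\<close> determine the imaginary and the real part
  respectively.\<close>

lemma positive_op_selfadjoint:
  fixes A :: "'a::complex_inner \<Rightarrow> 'a"
  assumes "positive_op A"
  shows "cinner (A x) y = cinner x (A y)"
proof -
  have lin: "bounded_clinear A" and real: "Im (cinner (A z) z) = 0" for z
    using assms by (auto simp: positive_op_def complex_is_Real_iff)
  have "Im (cinner (A x) y) + Im (cinner (A y) x) = 0"
    using real[of "x + y"] real[of x] real[of y]
    by (simp add: bounded_clinear_add[OF lin] cinner_add_left cinner_add_right)
  moreover have "Re (cinner (A x) y) = Re (cinner (A y) x)"
    using real[of "x + \<i> *\<^sub>C y"] real[of x] real[of y]
    by (simp add: bounded_clinear_add[OF lin] bounded_clinear_scaleC[OF lin] cinner_add_left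
        cinner_add_right cinner_scaleC_left cinner_scaleC_right)
  ultimately have "cinner (A x) y = cnj (cinner (A y) x)"
    by (simp add: complex_eq_iff)
  then show ?thesis
    by (metis cinner_commute)
qed

lemma A_norm_nonneg: "positive_op A \<Longrightarrow> 0 \<le> A_norm A x"
  by (simp add: positive_op_def A_norm_def A_inner_def)

lemma A_norm_square: "positive_op A \<Longrightarrow> (A_norm A x)\<^sup>2 = Re (cinner (A x) x)"
  by (simp add: positive_op_def A_norm_def A_inner_def)

lemma A_norm_square_add:
  fixes A :: "'a::complex_inner \<Rightarrow> 'a"
  assumes "positive_op A"
  shows "(A_norm A (x + y))\<^sup>2 = (A_norm A x)\<^sup>2 + 2 * Re (cinner (A x) y) + (A_norm A y)\<^sup>2"
proof -
  have lin: "bounded_clinear A"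
    using assms by (simp add: positive_op_def)
  have "Re (cinner (A y) x) = Re (cinner (A x) y)"
    by (metis assms positive_op_selfadjoint cinner_commute complex_cnj(1) complex.exhaust_sel complex.sel(1))
  then show ?thesis
    by (simp add: A_norm_square[OF assms] bounded_clinear_add[OF lin] cinner_add_left cinner_add_right)
qed

lemma A_norm_scaleR:
  assumes "positive_op A"
  shows "A_norm A (r *\<^sub>R x) = \<bar>r\<bar> * A_norm A x"
proof -
  have lin: "bounded_clinear A"
    using assms by (simp add: positive_op_def)
  have "(A_norm A (r *\<^sub>R x))\<^sup>2 = (\<bar>r\<bar> * A_norm A x)\<^sup>2"
    by (simp add: A_norm_square[OF assms] scaleR_scaleC bounded_clinear_scaleC[OF lin]
        cinner_scaleC_left cinner_scaleC_right power_mult_distrib power2_eq_square[of r])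
  then show ?thesis
    using A_norm_nonneg[OF assms] by (metis abs_ge_zero mult_nonneg_nonneg power2_eq_iff_nonneg)
qed

lemma A_norm_minus: "positive_op A \<Longrightarrow> A_norm A (- x) = A_norm A x"
  using A_norm_scaleR[of A "- 1" x] by simp

text \<open>The squared seminorm of \<open>x + r *\<^sub>R y\<close> is a nonnegative quadratic in
  \<open>r\<close>; the claim is its discriminant bound. The real part is what the triangle
  inequality calls for.\<close>

lemma A_norm_Cauchy_Schwarz:
  fixes A :: "'a::complex_inner \<Rightarrow> 'a"
  assumes "positive_op A"
  shows "\<bar>Re (cinner (A x) y)\<bar> \<le> A_norm A x * A_norm A y"
proof -
  have "0 \<le> (A_norm A x)\<^sup>2 + 2 * r * Re (cinner (A x) y) + r\<^sup>2 * (A_norm A y)\<^sup>2" for r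
    using A_norm_square_add[OF assms, of x "r *\<^sub>R y"] zero_le_power2[of "A_norm A (x + r *\<^sub>R y)"]
    by (simp add: A_norm_scaleR[OF assms] cinner_scaleR_right power_mult_distrib mult.assoc)
  then have "(Re (cinner (A x) y))\<^sup>2 \<le> (A_norm A x * A_norm A y)\<^sup>2"
    using quadratic_nonneg_imp_discriminant by (simp add: power_mult_distrib)
  then show ?thesis
    using A_norm_nonneg[OF assms] by (simp add: abs_le_square_iff[symmetric])
qed

lemma A_norm_triangle:
  assumes "positive_op A"
  shows "A_norm A (x + y) \<le> A_norm A x + A_norm A y"
proof (rule power2_le_imp_le)
  show "(A_norm A (x + y))\<^sup>2 \<le> (A_norm A x + A_norm A y)\<^sup>2"
    using A_norm_Cauchy_Schwarz[OF assms, of x y] A_norm_square_add[OF assms, of x y]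
    by (simp add: power2_sum)
qed (simp add: A_norm_nonneg[OF assms])

lemma A_norm_triangle_diff:
  "positive_op A \<Longrightarrow> A_norm A (x - y) \<le> A_norm A x + A_norm A y"
  using A_norm_triangle[of A x "- y"] by (simp add: A_norm_minus)

text \<open>Taking the identity for \<open>A\<close> turns the seminorm facts into facts about the
  norm itself.\<close>

lemma positive_op_id: "positive_op (\<lambda>x::'a::complex_inner. x)"
  by (simp add: positive_op_def bounded_clinear_def cinner_self)

lemma A_norm_id: "A_norm (\<lambda>x. x) = norm"
  by (simp add: fun_eq_iff A_norm_def A_inner_def norm_eq_sqrt_cinner)

lemmas norm_square_add = A_norm_square_add[OF positive_op_id, unfolded A_norm_id]
lemmas Re_cinner_le = A_norm_Cauchy_Schwarz[OF positive_op_id, unfolded A_norm_id]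

text \<open>The factor 2 comes from bounding real and imaginary parts separately; any constant will
  do for proving functionals bounded.\<close>

lemma norm_cinner_le: "cmod (cinner x y) \<le> 2 * norm x * norm (y::'a::complex_inner)"
proof -
  have "\<bar>Im (cinner x y)\<bar> \<le> norm x * norm y"
    using Re_cinner_le[of "\<i> *\<^sub>C x" y] by (simp add: cinner_scaleC_left norm_scaleC)
  then show ?thesis
    using Re_cinner_le[of x y] cmod_le[of "cinner x y"] by simp
qed

lemma bounded_linear_cinner_right: "bounded_linear (\<lambda>y. cinner x (y::'a::complex_inner))"
  by (rule bounded_linear_intro[where K = "2 * norm x"])
    (auto simp: cinner_add_right cinner_scaleC_right scaleR_scaleC scaleC_complex_def
      norm_cinner_le mult.commute[of "norm _"] intro: order_trans[OF norm_cinner_le])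

section \<open>Orthogonal projections\<close>

definition csubspace :: "'a::complex_inner set \<Rightarrow> bool"
  where "csubspace M \<longleftrightarrow>
    M \<noteq> {} \<and> (\<forall>x\<in>M. \<forall>y\<in>M. x + y \<in> M) \<and> (\<forall>c. \<forall>x\<in>M. c *\<^sub>C x \<in> M)"

lemma csubspace_scaleR: "csubspace M \<Longrightarrow> x \<in> M \<Longrightarrow> r *\<^sub>R x \<in> M"
  by (simp add: csubspace_def scaleR_scaleC)

lemma csubspace_diff: "csubspace M \<Longrightarrow> x \<in> M \<Longrightarrow> y \<in> M \<Longrightarrow> x - y \<in> M"
  using csubspace_scaleR[of M y "- 1"] unfolding csubspace_def
  by (metis scaleR_minus1_left uminus_add_conv_diff)

lemma csubspace_range:
  assumes "bounded_clinear T"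
  shows "csubspace (range T)"
  unfolding csubspace_def
  by (auto simp: bounded_clinear_add[OF assms, symmetric] bounded_clinear_scaleC[OF assms, symmetric])

lemma csubspace_closure:
  assumes "csubspace M"
  shows "csubspace (closure M)"
  unfolding csubspace_def
proof (intro conjI ballI allI)
  show "closure M \<noteq> {}"
    using assms by (simp add: csubspace_def)
  show "x + y \<in> closure M" if xy: "x \<in> closure M" "y \<in> closure M" for x y
  proof -
    obtain f g where "\<And>n. f n \<in> M" "f \<longlonglongrightarrow> x" "\<And>n. g n \<in> M" "g \<longlonglongrightarrow> y"
      using xy unfolding closure_sequential by blast
    then have "\<forall>n. f n + g n \<in> M" "(\<lambda>n. f n + g n) \<longlonglongrightarrow> x + y"
      using assms by (auto simp: csubspace_def intro: tendsto_add)
    then show ?thesis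
      unfolding closure_sequential by (intro exI[of _ "\<lambda>n. f n + g n"]) simp
  qed
  show "c *\<^sub>C x \<in> closure M" if x: "x \<in> closure M" for c x
  proof -
    obtain f where "\<And>n. f n \<in> M" "f \<longlonglongrightarrow> x"
      using x unfolding closure_sequential by blast
    then have "\<forall>n. c *\<^sub>C f n \<in> M" "(\<lambda>n. c *\<^sub>C f n) \<longlonglongrightarrow> c *\<^sub>C x"
      using assms by (auto simp: csubspace_def intro: bounded_linear.tendsto[OF bounded_linear_scaleC])
    then show ?thesis
      unfolding closure_sequential by (intro exI[of _ "\<lambda>n. c *\<^sub>C f n"]) simp
  qed
qed

lemma parallelogram:
  "(norm (x - y))\<^sup>2 + (norm (x + y))\<^sup>2 = 2 * (norm x)\<^sup>2 + 2 * (norm (y::'a::complex_inner))\<^sup>2"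
  using norm_square_add[of x y] norm_square_add[of x "- y"] by (simp add: cinner_minus_right)

text \<open>A minimising sequence is Cauchy by the parallelogram law; completeness provides its
  limit and closedness keeps the limit in \<open>M\<close>.\<close>

lemma nearest_point_exists:
  fixes M :: "'a::complex_hilbert_space set"
  assumes M: "csubspace M" "closed M"
  obtains y where "y \<in> M" "\<And>z. z \<in> M \<Longrightarrow> norm (x - y) \<le> norm (x - z)"
proof -
  define D where "D = (\<lambda>z. (norm (x - z))\<^sup>2) ` M"
  define d where "d = Inf D"
  have ne: "D \<noteq> {}" and bdd: "bdd_below D"
    using M by (auto simp: D_def csubspace_def intro: bdd_belowI[of _ 0])
  have lower: "d \<le> (norm (x - z))\<^sup>2" if "z \<in> M" for z
    unfolding d_def using bdd that by (auto simp: D_def intro: cInf_lower)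
  have "\<exists>z\<in>M. (norm (x - z))\<^sup>2 < d + 1 / real (Suc n)" for n
    using cInf_lessD[OF ne, of "d + 1 / real (Suc n)"] by (auto simp: d_def D_def)
  then obtain z where z: "\<And>n. z n \<in> M" "\<And>n. (norm (x - z n))\<^sup>2 < d + 1 / real (Suc n)"
    by metis
  have close: "(norm (z m - z n))\<^sup>2 \<le> 2 / real (Suc m) + 2 / real (Suc n)" for m n
  proof -
    \<comment> \<open>The midpoint lies in \<open>M\<close>, so its squared distance to
      \<open>x\<close> is at least \<open>d\<close>; this yields the term \<open>4 * d\<close>
      below.\<close>
    define w where "w = (1 / 2) *\<^sub>R (z m + z n)"
    have "z m + z n \<in> M"
      using M z(1) by (simp add: csubspace_def)
    then have "d \<le> (norm (x - w))\<^sup>2"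
      unfolding w_def by (intro lower csubspace_scaleR[OF M(1)])
    moreover have "(x - z n) + (x - z m) = 2 *\<^sub>R (x - w)"
      by (simp add: w_def scaleR_2 algebra_simps)
    moreover have "(x - z n) - (x - z m) = z m - z n"
      by simp
    ultimately have "(norm (z m - z n))\<^sup>2 + 4 * d \<le> 2 * (norm (x - z n))\<^sup>2 + 2 * (norm (x - z m))\<^sup>2"
      using parallelogram[of "x - z n" "x - z m"] by (simp add: power_mult_distrib)
    then show ?thesis
      using z(2)[of m] z(2)[of n] by simp
  qed
  have "Cauchy z"
  proof (rule metric_CauchyI)
    fix e :: real
    assume "e > 0"
    \<comment> \<open>Each of the two terms in \<open>close\<close> then stays below half of
      \<open>e\<^sup>2\<close>.\<close>
    then obtain k where k: "1 / real (Suc k) < e\<^sup>2 / 4"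
      by (metis nat_approx_posE zero_less_divide_iff zero_less_numeral zero_less_power)
    have "dist (z m) (z n) < e" if "m \<ge> k" "n \<ge> k" for m n
    proof (rule power2_less_imp_less)
      have "1 / real (Suc m) \<le> 1 / real (Suc k)" "1 / real (Suc n) \<le> 1 / real (Suc k)"
        using that by (auto intro!: divide_left_mono)
      then show "(dist (z m) (z n))\<^sup>2 < e\<^sup>2"
        using close[of m n] k by (simp add: dist_norm)
    qed (use \<open>e > 0\<close> in simp)
    then show "\<exists>k. \<forall>m\<ge>k. \<forall>n\<ge>k. dist (z m) (z n) < e"
      by blast
  qed
  then obtain y where y: "z \<longlonglongrightarrow> y"
    using Cauchy_convergent convergent_def by blast
  have "y \<in> M"
    using M(2) z(1) y closed_sequentially by blast
  moreover have "norm (x - y) \<le> norm (x - w)" if "w \<in> M" for w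
  proof -
    have "(\<lambda>n. (norm (x - z n))\<^sup>2) \<longlonglongrightarrow> (norm (x - y))\<^sup>2"
      by (intro tendsto_intros y)
    moreover have "(\<lambda>n. d + 1 / real (Suc n)) \<longlonglongrightarrow> d + 0"
      by (intro tendsto_add tendsto_const LIMSEQ_Suc[OF lim_1_over_n])
    ultimately have "(norm (x - y))\<^sup>2 \<le> d + 0"
      by (rule LIMSEQ_le) (use z(2) in \<open>auto intro: less_imp_le\<close>)
    then show ?thesis
      using lower[OF that] by (simp add: power2_le_imp_le)
  qed
  ultimately show thesis
    using that by blast
qed

text \<open>Moving \<open>y\<close> within \<open>M\<close> cannot shorten the distance. The
  resulting quadratic in \<open>r\<close> has constant term 0, so its linear coefficient vanishes;
  the direction \<open>\<i> *\<^sub>C z\<close> takes care of the imaginary part.\<close>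

lemma nearest_point_orthogonal:
  fixes M :: "'a::complex_inner set"
  assumes M: "csubspace M" and y: "y \<in> M" "\<And>z. z \<in> M \<Longrightarrow> norm (x - y) \<le> norm (x - z)"
    and z: "z \<in> M"
  shows "cinner (x - y) z = 0"
proof -
  have Re_zero: "Re (cinner (x - y) w) = 0" if "w \<in> M" for w
  proof -
    have "0 \<le> 0 + 2 * r * Re (cinner (x - y) w) + r\<^sup>2 * (norm w)\<^sup>2" for r
    proof -
      have "norm (x - y) \<le> norm (x - (y - r *\<^sub>R w))"
        by (intro y csubspace_diff M csubspace_scaleR that)
      then have "(norm (x - y))\<^sup>2 \<le> (norm ((x - y) + r *\<^sub>R w))\<^sup>2"
        by (simp add: algebra_simps power_mono)
      then show ?thesis
        using norm_square_add[of "x - y" "r *\<^sub>R w"]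
        by (simp add: power_mult_distrib cinner_scaleR_right mult.assoc)
    qed
    then have "(Re (cinner (x - y) w))\<^sup>2 \<le> 0 * (norm w)\<^sup>2"
      by (rule quadratic_nonneg_imp_discriminant) simp
    then show ?thesis
      by simp
  qed
  have "\<i> *\<^sub>C z \<in> M"
    using M z by (simp add: csubspace_def)
  then show ?thesis
    using Re_zero[OF z] Re_zero[of "\<i> *\<^sub>C z"] by (simp add: cinner_scaleC_right complex_eq_iff)
qed

text \<open>The difference of two candidates lies in \<open>M\<close> and is orthogonal to
  \<open>M\<close>, hence to itself.\<close>

lemma orth_proj_unique:
  fixes M :: "'a::complex_inner set"
  assumes "csubspace M" "y \<in> M" "\<And>z. z \<in> M \<Longrightarrow> cinner (x - y) z = 0"
    and "y' \<in> M" "\<And>z. z \<in> M \<Longrightarrow> cinner (x - y') z = 0"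
  shows "y' = y"
proof -
  have "y' - y \<in> M"
    using assms by (intro csubspace_diff)
  then have "cinner ((x - y) - (x - y')) (y' - y) = 0"
    using assms(3,5) by (simp only: cinner_diff_left) (simp add: cinner_diff_left)
  then show ?thesis
    by simp
qed

context
  fixes M :: "'a::complex_hilbert_space set"
  assumes M: "csubspace M" "closed M"
begin

lemma orth_proj:
  "orth_proj M x \<in> M" "z \<in> M \<Longrightarrow> cinner (x - orth_proj M x) z = 0"
proof -
  obtain y where y: "y \<in> M" "\<And>z. z \<in> M \<Longrightarrow> norm (x - y) \<le> norm (x - z)"
    using nearest_point_exists[OF M] by blast
  have "orth_proj M x \<in> M \<and> (\<forall>z\<in>M. cinner (x - orth_proj M x) z = 0)"
    unfolding orth_proj_def
  proof (rule theI)
    show "y \<in> M \<and> (\<forall>z\<in>M. cinner (x - y) z = 0)"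
      using y nearest_point_orthogonal[OF M(1) y] by blast
    then show "y' = y" if "y' \<in> M \<and> (\<forall>z\<in>M. cinner (x - y') z = 0)" for y'
      using that by (intro orth_proj_unique[OF M(1), of y x y']) auto
  qed
  then show "orth_proj M x \<in> M" "z \<in> M \<Longrightarrow> cinner (x - orth_proj M x) z = 0"
    by auto
qed

lemma orth_proj_eqI:
  assumes "y \<in> M" "\<And>z. z \<in> M \<Longrightarrow> cinner (x - y) z = 0"
  shows "orth_proj M x = y"
  using orth_proj_unique[OF M(1) assms orth_proj] .

lemma bounded_clinear_orth_proj: "bounded_clinear (orth_proj M)"
proof (rule bounded_clinearI[where K = 1])
  fix x y c
  show "orth_proj M (x + y) = orth_proj M x + orth_proj M y"
  proof (rule orth_proj_eqI)
    show "cinner (x + y - (orth_proj M x + orth_proj M y)) z = 0" if "z \<in> M" for z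
      using orth_proj(2)[OF that, of x] orth_proj(2)[OF that, of y]
      by (simp add: cinner_diff_left cinner_add_left)
  qed (use M(1) orth_proj(1) in \<open>auto simp: csubspace_def\<close>)
  show "orth_proj M (c *\<^sub>C x) = c *\<^sub>C orth_proj M x"
  proof (rule orth_proj_eqI)
    show "cinner (c *\<^sub>C x - c *\<^sub>C orth_proj M x) z = 0" if "z \<in> M" for z
      using orth_proj(2)[OF that, of x]
      by (simp add: scaleC_diff_right[symmetric] cinner_scaleC_left)
  qed (use M(1) orth_proj(1) in \<open>auto simp: csubspace_def\<close>)
  \<comment> \<open>Pythagoras for the two orthogonal components makes the projection a
    contraction.\<close>
  have "(norm x)\<^sup>2 = (norm (x - orth_proj M x))\<^sup>2 + (norm (orth_proj M x))\<^sup>2"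
    using norm_square_add[of "x - orth_proj M x" "orth_proj M x"] orth_proj by simp
  then have "(norm (orth_proj M x))\<^sup>2 \<le> (norm x)\<^sup>2"
    using zero_le_power2[of "norm (x - orth_proj M x)"] by linarith
  then show "norm (orth_proj M x) \<le> norm x * 1"
    by simp
qed

end

section \<open>Adjoints\<close>

theorem Riesz_representation:
  fixes f :: "'a::complex_hilbert_space \<Rightarrow> complex"
  assumes f: "bounded_linear f" and scale: "\<And>c x. f (c *\<^sub>C x) = c * f x"
  obtains y where "\<And>x. f x = cinner x y"
proof (cases "\<forall>x. f x = 0")
  case True
  then show thesis
    using that[of 0] by simp
next
  case False
  then obtain v where v: "f v \<noteq> 0"
    by blast
  define M where "M = f -` {0}"
  have f_add: "f (x + y) = f x + f y" and f_diff: "f (x - y) = f x - f y" for x y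
    using f by (simp_all add: linear_simps)
  have M: "csubspace M" "closed M"
  proof -
    have "f 0 = 0"
      using f_diff[of 0 0] by simp
    then show "csubspace M"
      by (auto simp: csubspace_def M_def f_add scale)
    show "closed M"
      unfolding M_def
      by (intro closed_vimage closed_singleton linear_continuous_on f)
  qed
  \<comment> \<open>\<open>w\<close> is orthogonal to the kernel \<open>M\<close> of
    \<open>f\<close>, and \<open>f w\<close> is nonzero.\<close>
  define w where "w = v - orth_proj M v"
  have fw: "f w = f v"
    using orth_proj(1)[OF M, of v] by (simp add: w_def M_def f_diff)
  then have "w \<noteq> 0"
    using v f_diff[of 0 0] by auto
  then have ww: "cinner w w \<noteq> 0"
    by simp
  \<comment> \<open>Subtracting a multiple of \<open>w\<close> moves \<open>x\<close> into the
    kernel, hence orthogonal to \<open>w\<close>. The \<open>cnj\<close> compensates conjugate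
    linearity in the second argument.\<close>
  have "f x = cinner x (cnj (f w / cinner w w) *\<^sub>C w)" for x
  proof -
    have "x - (f x / f w) *\<^sub>C w \<in> M"
      using v fw by (simp add: M_def f_diff scale)
    then have "cinner w (x - (f x / f w) *\<^sub>C w) = 0"
      unfolding w_def by (rule orth_proj(2)[OF M])
    then have "cinner (x - (f x / f w) *\<^sub>C w) w = 0"
      by (metis cinner_commute complex_cnj_zero)
    then have "cinner x w = f x / f w * cinner w w"
      by (simp add: cinner_diff_left cinner_scaleC_left)
    then show ?thesis
      using v fw ww by (simp add: cinner_scaleC_right)
  qed
  then show thesis
    using that by blast
qed

lemma cinner_ext:
  assumes "\<And>x. cinner x y = cinner x (z::'a::complex_inner)"
  shows "y = z"
  using assms[of "y - z"] cinner_eq_zero_iff[of "y - z"] by (simp add: cinner_diff_right)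

text \<open>For each \<open>y\<close>, \<open>S y\<close> is the Riesz vector of the functional
  sending \<open>x\<close> to \<open>cinner (T x) y\<close>.\<close>

lemma adjoint_exists:
  fixes T :: "'a::complex_hilbert_space \<Rightarrow> 'a"
  assumes T: "bounded_clinear T"
  obtains S where "bounded_clinear S" "\<And>x y. cinner (T x) y = cinner x (S y)"
proof -
  have "\<exists>z. \<forall>x. cinner (T x) y = cinner x z" for y
  proof -
    obtain K where K: "\<And>x. norm (T x) \<le> norm x * K" "K \<ge> 0"
      using T by (metis bounded_clinear_def bounded_linear.nonneg_bounded)
    have "bounded_linear (\<lambda>x. cinner (T x) y)"
    proof (rule bounded_linear_intro)
      show "norm (cinner (T x) y) \<le> norm x * (2 * K * norm y)" for x
      proof -
        have "norm (cinner (T x) y) \<le> 2 * norm (T x) * norm y"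
          by (rule norm_cinner_le)
        also have "\<dots> \<le> 2 * (norm x * K) * norm y"
          by (intro mult_mono K mult_nonneg_nonneg) (auto simp: K)
        finally show ?thesis
          by (simp add: ac_simps)
      qed
    qed (auto simp: bounded_clinear_add[OF T] bounded_clinear_scaleC[OF T] cinner_add_left
        cinner_scaleC_left scaleR_scaleC scaleC_complex_def)
    then show ?thesis
      by (rule Riesz_representation)
        (auto simp: bounded_clinear_scaleC[OF T] cinner_scaleC_left)
  qed
  then obtain S where S: "\<And>x y. cinner (T x) y = cinner x (S y)"
    by metis
  obtain K where K: "\<And>x. norm (T x) \<le> norm x * K"
    using T by (metis bounded_clinear_def bounded_linear.bounded)
  have "bounded_clinear S"
  proof (rule bounded_clinearI)
    fix x y c
    show "S (x + y) = S x + S y"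
      by (rule cinner_ext) (simp add: S[symmetric] cinner_add_right)
    show "S (c *\<^sub>C x) = c *\<^sub>C S x"
      by (rule cinner_ext) (simp add: S[symmetric] cinner_scaleC_right)
    \<comment> \<open>Testing the adjoint identity at \<open>S x\<close> itself; one factor
      \<open>norm (S x)\<close> cancels at the end, so \<open>S\<close> inherits the bound
      \<open>K\<close> of \<open>T\<close>.\<close>
    have "norm (S x) * norm (S x) = Re (cinner (T (S x)) x)"
      by (simp add: S cinner_self power2_eq_square)
    also have "\<dots> \<le> norm (T (S x)) * norm x"
      using Re_cinner_le[of "T (S x)" x] by simp
    also have "\<dots> \<le> (norm (S x) * K) * norm x"
      by (intro mult_right_mono K) simp
    finally have "norm (S x) * norm (S x) \<le> norm (S x) * (norm x * K)"
      by (simp add: ac_simps)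
    moreover have "0 \<le> norm x * K"
      using K[of x] norm_ge_zero order_trans by blast
    ultimately show "norm (S x) \<le> norm x * K"
      by (cases "S x = 0") auto
  qed
  then show thesis
    using that S by blast
qed

lemma cinner_cadjoint:
  fixes T :: "'a::complex_hilbert_space \<Rightarrow> 'a"
  assumes "bounded_clinear T"
  shows "cinner (T x) y = cinner x (cadjoint T y)"
proof -
  obtain S where S: "bounded_clinear S" "\<And>x y. cinner (T x) y = cinner x (S y)"
    using adjoint_exists[OF assms] by blast
  have "cadjoint T = S"
    unfolding cadjoint_def
  proof (rule the_equality)
    fix S'
    assume S': "bounded_clinear S' \<and> (\<forall>x y. cinner (T x) y = cinner x (S' y))"
    show "S' = S"
    proof
      fix y
      have "cinner x (S' y) = cinner x (S y)" for x
        using S' S(2) by metis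
      then show "S' y = S y"
        by (rule cinner_ext)
    qed
  qed (use S in blast)
  then show ?thesis
    by (simp add: S)
qed

section \<open>The distinguished \<open>A\<close>-adjoint and \<open>A\<close>-unitary
  operators\<close>

lemma A_A_proj:
  fixes A :: "'a::complex_hilbert_space \<Rightarrow> 'a"
  assumes A: "positive_op A"
  shows "A (A_proj A x) = A x"
proof -
  have lin: "bounded_clinear A"
    using A by (simp add: positive_op_def)
  have M: "csubspace (closure (range A))" "closed (closure (range A))"
    using csubspace_closure[OF csubspace_range[OF lin]] by auto
  \<comment> \<open>The vector \<open>x - A_proj A x\<close> is orthogonal to the range of the
    self-adjoint \<open>A\<close>, hence lies in its kernel.\<close>
  have "cinner y (A (x - A_proj A x)) = cinner y 0" for y
  proof -
    have "A y \<in> closure (range A)"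
      by (metis closure_subset rangeI subsetD)
    then have "cinner (x - A_proj A x) (A y) = 0"
      unfolding A_proj_def by (rule orth_proj(2)[OF M])
    then show ?thesis
      by (metis A cinner_commute cinner_zero_right complex_cnj_zero positive_op_selfadjoint)
  qed
  then have "A (x - A_proj A x) = 0"
    by (rule cinner_ext)
  then show ?thesis
    by (simp add: bounded_clinear_diff[OF lin])
qed

text \<open>The kernel of a self-adjoint operator is orthogonal to the closure of its range. This is
  the uniqueness behind \<open>A_adjoint\<close>.\<close>

lemma positive_op_inj_on_closure_range:
  fixes A :: "'a::complex_inner \<Rightarrow> 'a"
  assumes A: "positive_op A" and "x \<in> closure (range A)" "y \<in> closure (range A)" "A x = A y"
  shows "x = y"
proof -
  have lin: "bounded_clinear A"
    using A by (simp add: positive_op_def)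
  define z where "z = x - y"
  have "z \<in> closure (range A)"
    unfolding z_def by (intro csubspace_diff csubspace_closure csubspace_range lin assms)
  moreover have "cinner z w = 0" if "w \<in> range A" for w
    using that assms(4)
    by (auto simp: positive_op_selfadjoint[OF A, symmetric] z_def bounded_clinear_diff[OF lin])
  then have "closure (range A) \<subseteq> cinner z -` {0}"
    by (intro closure_minimal closed_vimage closed_singleton linear_continuous_on
        bounded_linear_cinner_right) auto
  ultimately have "cinner z z = 0"
    by auto
  then show ?thesis
    by (simp add: z_def)
qed

text \<open>Justifies the definite description in \<open>A_adjoint\<close>: projecting an arbitrary
  solution \<open>X\<close> keeps the equation, because \<open>A\<close> absorbs
  \<open>A_proj A\<close>, and puts the range where it is required.\<close>

lemma A_comp_A_adjoint:
  fixes A :: "'a::complex_hilbert_space \<Rightarrow> 'a"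
  assumes A: "positive_op A" and T: "T \<in> A_adjointable_ops A"
  shows "A \<circ> A_adjoint A T = cadjoint T \<circ> A"
proof -
  let ?Q = "\<lambda>X. bounded_clinear X \<and> A \<circ> X = cadjoint T \<circ> A \<and> range X \<subseteq> closure (range A)"
  have lin: "bounded_clinear A"
    using A by (simp add: positive_op_def)
  have M: "csubspace (closure (range A))" "closed (closure (range A))"
    using csubspace_closure[OF csubspace_range[OF lin]] by auto
  obtain X where X: "bounded_clinear X" "A \<circ> X = cadjoint T \<circ> A"
    using T by (auto simp: A_adjointable_ops_def)
  have "bounded_clinear (A_proj A)"
    unfolding A_proj_def by (rule bounded_clinear_orth_proj[OF M])
  then have Q: "?Q (A_proj A \<circ> X)"
    using X A_A_proj[OF A] orth_proj(1)[OF M]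
    by (auto simp: bounded_clinear_compose fun_eq_iff A_proj_def)
  have "A_adjoint A T = A_proj A \<circ> X"
    unfolding A_adjoint_def
  proof (rule the_equality, rule Q)
    fix Y
    assume Y: "?Q Y"
    show "Y = A_proj A \<circ> X"
    proof
      fix x
      have "A (Y x) = A ((A_proj A \<circ> X) x)"
        using Q Y by (metis comp_apply)
      then show "Y x = (A_proj A \<circ> X) x"
        using Q Y by (metis A positive_op_inj_on_closure_range range_subsetD)
    qed
  qed
  then show ?thesis
    using Q by simp
qed

lemma A_unitary_A_norm:
  fixes A U :: "'a::complex_hilbert_space \<Rightarrow> 'a"
  assumes A: "positive_op A" and U: "A_unitary A U"
  shows "A_norm A (U x) = A_norm A x"
proof -
  have adj: "U \<in> A_adjointable_ops A" and proj: "A_adjoint A U \<circ> U = A_proj A"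
    using U by (auto simp: A_unitary_def)
  have lin: "bounded_clinear U"
    using adj by (simp add: A_adjointable_ops_def)
  have "cadjoint U (A (U x)) = A (A_adjoint A U (U x))"
    using A_comp_A_adjoint[OF A adj] by (metis comp_apply)
  also have "\<dots> = A x"
    using proj A_A_proj[OF A] by (metis comp_apply)
  \<comment> \<open>Pairing with \<open>x\<close> moves \<open>cadjoint U\<close> back as
    \<open>U\<close> on the left.\<close>
  finally have "cinner (U x) (A (U x)) = cinner x (A x)"
    by (simp add: cinner_cadjoint[OF lin])
  then show ?thesis
    by (simp add: A_norm_def A_inner_def positive_op_selfadjoint[OF A])
qed

section \<open>The operator seminorm and the spectral radius\<close>

lemma A_opnorm_bound:
  assumes A: "positive_op A" and T: "T \<in> A_bounded_ops A"
  shows "A_norm A (T x) \<le> A_opnorm A T * A_norm A x"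
proof -
  obtain c where lin: "bounded_clinear T" and c: "\<And>x. A_norm A (T x) \<le> c * A_norm A x"
    using T by (auto simp: A_bounded_ops_def)
  show ?thesis
  proof (cases "A_norm A x = 0")
    \<comment> \<open>The supremum sees unit vectors only; on seminorm-null vectors the constant
      \<open>c\<close> shows that \<open>T x\<close> is null too.\<close>
    case True
    then show ?thesis
      using c[of x] by simp
  next
    case False
    then have pos: "A_norm A x > 0"
      using A_norm_nonneg[OF A, of x] by simp
    define y where "y = (1 / A_norm A x) *\<^sub>R x"
    have y: "A_norm A y = 1"
      using pos by (simp add: y_def A_norm_scaleR[OF A])
    have "A_norm A (T y) \<le> (SUP z\<in>{z. A_norm A z = 1}. A_norm A (T z))"
    proof (rule cSUP_upper)
      show "bdd_above ((\<lambda>z. A_norm A (T z)) ` {z. A_norm A z = 1})"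
        using c by (intro bdd_aboveI[of _ c]) (auto, metis mult.right_neutral)
    qed (use y in simp)
    then have "A_norm A (T y) \<le> A_opnorm A T"
      using y by (auto simp: A_opnorm_def)
    moreover have "A_norm A (T y) = A_norm A (T x) / A_norm A x"
      using pos by (simp add: y_def bounded_clinear_scaleR[OF lin] A_norm_scaleR[OF A])
    ultimately show ?thesis
      using pos by (simp add: field_simps)
  qed
qed

lemma A_opnorm_le:
  assumes "\<And>x. A_norm A (T x) \<le> c * A_norm A x" "0 \<le> c"
  shows "A_opnorm A T \<le> c"
  unfolding A_opnorm_def using assms by (auto intro!: cSUP_least) (metis mult.right_neutral)

text \<open>Assumes a mere seminorm bound, so that it applies to the powers of an \<open>S\<close>
  known only through estimates.\<close>

lemma A_opnorm_nonneg:
  assumes A: "positive_op A" and c: "\<And>x. A_norm A (T x) \<le> c * A_norm A x"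
  shows "0 \<le> A_opnorm A T"
proof (cases "{x. A_norm A x = 1} = {}")
  case False
  then obtain x where "A_norm A x = 1"
    by blast
  moreover have "bdd_above ((\<lambda>z. A_norm A (T z)) ` {z. A_norm A z = 1})"
    using c by (intro bdd_aboveI[of _ c]) (auto, metis mult.right_neutral)
  ultimately have "A_norm A (T x) \<le> (SUP z\<in>{z. A_norm A z = 1}. A_norm A (T z))"
    by (intro cSUP_upper) auto
  then show ?thesis
    using False A_norm_nonneg[OF A, of "T x"] by (simp add: A_opnorm_def)
qed (simp add: A_opnorm_def)

lemma A_bounded_ops_nonneg_opnorm:
  "positive_op A \<Longrightarrow> T \<in> A_bounded_ops A \<Longrightarrow> 0 \<le> A_opnorm A T"
  by (rule A_opnorm_nonneg[OF _ A_opnorm_bound])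

lemma A_bounded_ops_compose:
  assumes A: "positive_op A" and "S \<in> A_bounded_ops A" "T \<in> A_bounded_ops A"
  shows "S \<circ> T \<in> A_bounded_ops A"
proof -
  obtain c d where c: "c > 0" "\<And>x. A_norm A (S x) \<le> c * A_norm A x"
    and d: "d > 0" "\<And>x. A_norm A (T x) \<le> d * A_norm A x"
    and lin: "bounded_clinear S" "bounded_clinear T"
    using assms(2,3) by (auto simp: A_bounded_ops_def)
  have "A_norm A (S (T x)) \<le> c * d * A_norm A x" for x
    using order_trans[OF c(2)[of "T x"] mult_left_mono[OF d(2)[of x], of c]] c(1)
    by (simp add: mult.assoc)
  then show ?thesis
    using c(1) d(1) bounded_clinear_compose[OF lin]
    by (auto simp: A_bounded_ops_def intro: exI[of _ "c * d"])
qed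

text \<open>Each \<open>n\<close> bounds the infimum by \<open>root n K * r\<close>, and
  \<open>root n K\<close> tends to 1, so \<open>K\<close> disappears in the limit.\<close>

lemma A_spectral_radius_le:
  assumes A: "positive_op A" and "0 \<le> r" "0 < K"
    and pow: "\<And>n x. 1 \<le> n \<Longrightarrow> A_norm A ((S ^^ n) x) \<le> K * r ^ n * A_norm A x"
  shows "A_spectral_radius A S \<le> r"
proof -
  have bdd: "bdd_below ((\<lambda>n. root n (A_opnorm A (S ^^ n))) ` {1..})"
    using A_opnorm_nonneg[OF A pow] by (intro bdd_belowI[of _ 0]) auto
  have "A_spectral_radius A S \<le> root n K * r" if "1 \<le> n" for n
  proof -
    have "A_opnorm A (S ^^ n) \<le> K * r ^ n"
      using assms that by (intro A_opnorm_le pow) auto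
    then have "root n (A_opnorm A (S ^^ n)) \<le> root n (K * r ^ n)"
      using that by simp
    also have "\<dots> = root n K * r"
      using that \<open>0 \<le> r\<close> by (simp add: real_root_mult real_root_power_cancel)
    finally show ?thesis
      unfolding A_spectral_radius_def using bdd that by (intro cINF_lower2) auto
  qed
  moreover have "(\<lambda>n. root n K * r) \<longlonglongrightarrow> 1 * r"
    by (intro tendsto_intros LIMSEQ_root_const \<open>0 < K\<close>)
  ultimately have "A_spectral_radius A S \<le> 1 * r"
    by (intro LIMSEQ_le_const) auto
  then show ?thesis
    by simp
qed

text \<open>Stated through norm inequalities so as to cover both signs, and for a strict bound \<open>s\<close> so that
  the weight in \<open>\<phi>\<close> does not vanish when \<open>T\<^sup>2\<close> has seminorm zero.\<close>

lemma A_spectral_radius_commutator_le: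
  assumes A: "positive_op A"
    and U: "\<And>x. A_norm A (U x) = A_norm A x"
    and T: "\<And>x. A_norm A (T x) \<le> t * A_norm A x" "0 \<le> t"
    and T2: "\<And>x. A_norm A (T (T x)) \<le> s\<^sup>2 * A_norm A x" "0 < s"
    and S: "\<And>x. A_norm A (S x) \<le> A_norm A (T (U x)) + A_norm A (U (T x))"
    and US: "\<And>x. A_norm A (U (S x)) \<le> A_norm A (U (T (U x))) + A_norm A (U (U (T x)))"
    and TS: "\<And>x. A_norm A (T (S x)) \<le> A_norm A (T (T (U x))) + A_norm A (T (U (T x)))"
  shows "A_spectral_radius A S \<le> t + s"
proof -
  define \<phi> where "\<phi> x = s * A_norm A (U x) + A_norm A (T x)" for x
  have \<phi>_S: "\<phi> (S x) \<le> (t + s) * \<phi> x" for x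
  proof -
    have "A_norm A (U (S x)) \<le> t * A_norm A (U x) + A_norm A (T x)"
      using US[of x] T(1)[of "U x"] by (simp add: U)
    then have "s * A_norm A (U (S x)) \<le> s * (t * A_norm A (U x) + A_norm A (T x))"
      using T2(2) by (intro mult_left_mono) auto
    \<comment> \<open>The summand with two consecutive factors \<open>T\<close> is charged to
      \<open>s\<^sup>2\<close>, the one with \<open>U\<close> in between to
      \<open>t\<close>.\<close>
    moreover have "A_norm A (T (S x)) \<le> s\<^sup>2 * A_norm A (U x) + t * A_norm A (T x)"
      using TS[of x] T2(1)[of "U x"] T(1)[of "U (T x)"] by (simp add: U)
    \<comment> \<open>The two right-hand sides add up to exactly \<open>(t + s) * \<phi> x\<close>;
      the weight \<open>s\<close> in \<open>\<phi>\<close> is chosen for this factorisation.\<close>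
    ultimately show ?thesis
      by (simp add: \<phi>_def algebra_simps power2_eq_square)
  qed
  have \<phi>_pow: "\<phi> ((S ^^ n) x) \<le> (t + s) ^ n * \<phi> x" for n x
  proof (induction n)
    case (Suc n)
    have "\<phi> ((S ^^ Suc n) x) \<le> (t + s) * \<phi> ((S ^^ n) x)"
      using \<phi>_S by simp
    also have "\<dots> \<le> (t + s) * ((t + s) ^ n * \<phi> x)"
      using Suc T(2) T2(2) by (intro mult_left_mono) auto
    finally show ?case
      by simp
  qed simp
  have \<phi>_le: "\<phi> x \<le> (t + s) * A_norm A x" for x
    using T(1)[of x] by (simp add: \<phi>_def U algebra_simps)
  \<comment> \<open>In \<open>K * \<phi> x\<close>, \<open>t / s\<close> times the first term of
    \<open>\<phi>\<close> covers \<open>t * A_norm A (U x)\<close>, and 1 covers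
    \<open>A_norm A (T x)\<close>.\<close>
  define K where "K = t / s + 1"
  have "K > 0"
    using T(2) T2(2) by (simp add: K_def add_nonneg_pos)
  have S_le: "A_norm A (S x) \<le> K * \<phi> x" for x
  proof -
    have "A_norm A (S x) \<le> t * A_norm A (U x) + A_norm A (T x)"
      using S[of x] T(1)[of "U x"] by (simp add: U)
    also have "\<dots> \<le> (t * A_norm A (U x) + A_norm A (T x)) + (t / s * A_norm A (T x) + s * A_norm A (U x))"
      using T(2) T2(2) A_norm_nonneg[OF A] by simp
    also have "\<dots> = K * \<phi> x"
      using T2(2) by (simp add: K_def \<phi>_def field_simps)
    finally show ?thesis .
  qed
  show ?thesis
  proof (rule A_spectral_radius_le[OF A _ \<open>K > 0\<close>])
    fix n :: nat and x
    assume "1 \<le> n"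
    \<comment> \<open>The outermost \<open>S\<close> is spent on passing from the seminorm to
      \<open>\<phi>\<close>; the factor \<open>t + s\<close> missing from the power \<open>m\<close>
      returns through \<open>\<phi>_le\<close>.\<close>
    then obtain m where n: "n = Suc m"
      by (cases n) auto
    have "A_norm A ((S ^^ n) x) \<le> K * \<phi> ((S ^^ m) x)"
      using S_le by (simp add: n)
    also have "\<dots> \<le> K * ((t + s) ^ m * ((t + s) * A_norm A x))"
      using \<open>K > 0\<close> T(2) T2(2)
      by (intro mult_left_mono order_trans[OF \<phi>_pow] \<phi>_le) auto
    finally show "A_norm A ((S ^^ n) x) \<le> K * (t + s) ^ n * A_norm A x"
      by (simp add: n ac_simps)
  qed (use T(2) T2(2) in simp)
qed

theorem corollary2p2:
  fixes A U T :: "'a::complex_hilbert_space \<Rightarrow> 'a"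
  assumes "positive_op A"
    and "U \<in> A_adjointable_ops A"
    and "A_unitary A U"
    and "T \<in> A_bounded_ops A"
  shows "A_spectral_radius A (\<lambda>x. (T \<circ> U) x + (U \<circ> T) x) \<le> A_opnorm A T + sqrt (A_opnorm A (T ^^ 2))
    \<and> A_spectral_radius A (\<lambda>x. (T \<circ> U) x - (U \<circ> T) x) \<le> A_opnorm A T + sqrt (A_opnorm A (T ^^ 2))"
proof -
  note A = assms(1) and T = assms(4)
  define t where "t = A_opnorm A T"
  define q where "q = A_opnorm A (T ^^ 2)"
  have linU: "bounded_clinear U" and linT: "bounded_clinear T"
    using assms by (auto simp: A_adjointable_ops_def A_bounded_ops_def)
  have T2: "T ^^ 2 \<in> A_bounded_ops A"
    using A_bounded_ops_compose[OF A T T] by (simp add: numeral_2_eq_2)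
  have q: "0 \<le> q"
    unfolding q_def by (rule A_bounded_ops_nonneg_opnorm[OF A T2])
  have U_le: "A_norm A (U x) = A_norm A x" for x
    by (rule A_unitary_A_norm[OF A assms(3)])
  have T_le: "A_norm A (T x) \<le> t * A_norm A x" "0 \<le> t" for x
    unfolding t_def by (rule A_opnorm_bound[OF A T], rule A_bounded_ops_nonneg_opnorm[OF A T])
  \<comment> \<open>Adding \<open>e\<close> keeps the weight positive even if
    \<open>q = 0\<close>.\<close>
  have T2_le: "A_norm A (T (T x)) \<le> (sqrt q + e)\<^sup>2 * A_norm A x" if "e > 0" for x e
  proof -
    have "A_norm A (T (T x)) \<le> q * A_norm A x"
      using A_opnorm_bound[OF A T2, of x] by (simp add: q_def numeral_2_eq_2)
    also have "q \<le> (sqrt q + e)\<^sup>2"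
      using q that by (simp add: power2_sum)
    finally show ?thesis
      using A_norm_nonneg[OF A, of x] by (simp add: mult_right_mono)
  qed
  have s_pos: "0 < sqrt q + e" if "e > 0" for e
    using q that by (simp add: add_nonneg_pos)
  \<comment> \<open>Additivity of \<open>U\<close> and \<open>T\<close> with the triangle inequality
    supplies the three estimates on \<open>S\<close>; the other sign is analogous.\<close>
  have "A_spectral_radius A (\<lambda>x. T (U x) + U (T x)) \<le> t + sqrt q + e" if e: "e > 0" for e
    using A_spectral_radius_commutator_le[OF A U_le T_le T2_le[OF e] s_pos[OF e]]
    by (simp add: bounded_clinear_add[OF linU] bounded_clinear_add[OF linT] A_norm_triangle[OF A]
        add.assoc)
  moreover have "A_spectral_radius A (\<lambda>x. T (U x) - U (T x)) \<le> t + sqrt q + e" if e: "e > 0" for e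
    using A_spectral_radius_commutator_le[OF A U_le T_le T2_le[OF e] s_pos[OF e]]
    by (simp add: bounded_clinear_diff[OF linU] bounded_clinear_diff[OF linT]
        A_norm_triangle_diff[OF A] add.assoc)
  ultimately show ?thesis
    unfolding t_def[symmetric] q_def[symmetric] by (auto intro: field_le_epsilon)
qed

end
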